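(* Let $B_1,B_2,\dots,B_k\in\mathbb{C}^{n\times n}$ be nonsingular bidiagonal matrices (each of which may be upper bidiagonal or lower bidiagonal) and let $B = B_1B_2\cdots B_k$. Let $\delta\ge 0$ with $(2n-1)\delta<1$, put $$\tau = \frac{(2n-1)\delta}{1-(2n-1)\delta},$$ and let $B+\Delta B = (B_1+\Delta B_1)(B_2+\Delta B_2)\cdots(B_k+\Delta B_k)$, where $|\Delta B_i|\le \delta|B_i|$ for all $i$. Then $$\bigl|(B+\Delta B)^{-1}-B^{-1}\bigr| \le \bigl((1+\tau)^k-1\bigr)\,|B_k^{-1}|\,|B_{k-1}^{-1}|\cdots|B_1^{-1}|,$$ and if either all the $B_i$ are nonnegative or all the $B_i^{-1}$ are nonnegative then $$\bigl|(B+\Delta B)^{-1}-B^{-1}\bigr| \le \bigl((1+\tau)^k-1\bigr)\,|B^{-1}|.$$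
   Context: For a matrix $A=(a_{ij})$, $|A|=(|a_{ij}|)$ denotes the matrix of absolute values, and inequalities between matrices hold componentwise. A matrix is nonnegative if all its entries are real and nonnegative. A matrix is upper bidiagonal if its only possibly nonzero entries are in positions $(i,i)$ and $(i,i+1)$; it is lower bidiagonal if its transpose is upper bidiagonal; it is bidiagonal if it is upper or lower bidiagonal. *)

theory Defs
  imports
    Complex_Main
    "HOL-Library.Nonpos_Ints"
    "Jordan_Normal_Form.Gauss_Jordan_Elimination"
begin

(* The componentwise order between real matrices is the library's instance (\<le>) of type mat. *)

definition mat_abs :: "complex mat \<Rightarrow> real mat"
  where "mat_abs A = map_mat cmod A"

definition nonneg_mat :: "complex mat \<Rightarrow> bool"
  where "nonneg_mat A \<longleftrightarrow>
    (\<forall>i < dim_row A. \<forall>j < dim_col A. A $$ (i, j) \<in> \<real>\<^sub>\<ge>\<^sub>0)"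

definition upper_bidiagonal :: "complex mat \<Rightarrow> bool"
  where "upper_bidiagonal A \<longleftrightarrow>
    (\<forall>i < dim_row A. \<forall>j < dim_col A. j \<noteq> i \<and> j \<noteq> i + 1 \<longrightarrow> A $$ (i, j) = 0)"

definition lower_bidiagonal :: "complex mat \<Rightarrow> bool"
  where "lower_bidiagonal A \<longleftrightarrow> upper_bidiagonal (transpose_mat A)"

definition bidiagonal :: "complex mat \<Rightarrow> bool"
  where "bidiagonal A \<longleftrightarrow> upper_bidiagonal A \<or> lower_bidiagonal A"

(* The size n is an argument because square matrices of varying dimension form no monoid
   type class: the empty product needs to know its dimension. *)
definition mat_prod :: "nat \<Rightarrow> 'a :: semiring_1 mat list \<Rightarrow> 'a mat"
  where "mat_prod n As = foldr (*) As (1\<^sub>m n)"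

(* Meaningful only for nonsingular matrices; unspecified otherwise. *)
definition mat_inv :: "'a :: field mat \<Rightarrow> 'a mat"
  where "mat_inv A = the (mat_inverse A)"

lemma mat_inv:
  fixes A :: "'a :: field mat"
  assumes A: "A \<in> carrier_mat n n" and inv: "invertible_mat A"
  shows "mat_inv A \<in> carrier_mat n n" "A * mat_inv A = 1\<^sub>m n" "mat_inv A * A = 1\<^sub>m n"
proof -
  from inv obtain C where C: "A * C = 1\<^sub>m (dim_row A)" "C * A = 1\<^sub>m (dim_row C)"
    unfolding invertible_mat_def inverts_mat_def by auto
  have "dim_col C = n" using arg_cong[OF C(1), of dim_col] A by simp
  moreover have "dim_row C = n" using arg_cong[OF C(2), of dim_col] A by simp
  ultimately have "C \<in> carrier_mat n n" by auto
  with A C have "A \<in> Units (ring_mat TYPE('a) n ())"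
    unfolding Units_def ring_mat_def by auto
  with mat_inverse(1)[OF A, where b = "()"] obtain D where D: "mat_inverse A = Some D"
    by (cases "mat_inverse A") blast+
  with mat_inverse(2)[OF A D]
  show "mat_inv A \<in> carrier_mat n n" "A * mat_inv A = 1\<^sub>m n" "mat_inv A * A = 1\<^sub>m n"
    by (auto simp: mat_inv_def)
qed

end

theory Submission
  imports Defs "Jordan_Normal_Form.Determinant"
begin

text \<open>The inverse of a nonsingular bidiagonal matrix is obtained without additions: back
  substitution expresses each of its nonzero entries, up to sign, as a single product of at most \<open>2 n - 1\<close> entries
  of the matrix and their reciprocals (\<open>upper_bidiagonal_inverse_entries\<close>). Changing every
  entry by a relative error of at most \<open>\<delta>\<close> therefore changes every entry of the inverse by a
  relative error of at most \<open>\<tau>\<close> (\<open>bidiagonal_inverse_perturbation\<close>).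

  The inverse of \<open>B\<^sub>1 \<cdots> B\<^sub>k\<close> is the product of the inverses in reverse order. When each factor
  of a product has componentwise relative error \<open>\<tau>\<close>, the product differs from the exact one by
  at most \<open>(1 + \<tau>) ^ k - 1\<close> times the product of the absolute values
  (\<open>mat_prod_perturbation\<close>), which is the first bound.

  For the second bound, that product of absolute values must equal the absolute value of the
  product \<open>B\<^sup>-\<^sup>1\<close>. This is plain if all inverses are nonnegative. If all \<open>B\<^sub>i\<close> are nonnegative, the
  inverses share the checkerboard sign pattern \<open>(-1) ^ (i + j)\<close>
  (\<open>nonneg_bidiagonal_inverse_signs\<close>), that is, they become nonnegative after conjugation by
  one diagonal matrix of signs. Both cases are instances of a common signature, under which no
  cancellation occurs in products (\<open>signature_similar_abs_mat_prod\<close>).\<close>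

section \<open>Entries and inverses of square matrices\<close>

lemma index_mult_mat_sum:
  assumes "A \<in> carrier_mat n m" "B \<in> carrier_mat m p" "i < n" "j < p"
  shows "(A * B) $$ (i, j) = (\<Sum>l<m. A $$ (i, l) * B $$ (l, j))"
  using assms by (auto simp: scalar_prod_def atLeast0LessThan)

lemma invertible_matI:
  assumes "A \<in> carrier_mat n n" "X \<in> carrier_mat n n" "A * X = 1\<^sub>m n" "X * A = 1\<^sub>m n"
  shows "invertible_mat A"
  using assms unfolding invertible_mat_def inverts_mat_def by (auto intro!: exI[of _ X])

lemma invertible_mat_if_det_nz:
  fixes A :: "'a :: field mat"
  assumes A: "A \<in> carrier_mat n n" and "det A \<noteq> 0"
  shows "invertible_mat A"
  using det_non_zero_imp_unit[OF assms, where b = "()"] A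
  unfolding Units_def ring_mat_def by (auto intro: invertible_matI)

lemma det_nz_if_invertible_mat:
  fixes A :: "'a :: field mat"
  assumes A: "A \<in> carrier_mat n n" and inv: "invertible_mat A"
  shows "det A \<noteq> 0"
  using det_mult[OF A mat_inv(1)[OF A inv]] mat_inv(2)[OF A inv] by auto

lemma mat_inv_unique:
  fixes A :: "'a :: field mat"
  assumes A: "A \<in> carrier_mat n n" and X: "X \<in> carrier_mat n n" and AX: "A * X = 1\<^sub>m n"
  shows "mat_inv A = X"
proof -
  have inv: "invertible_mat A"
    using invertible_matI[OF A X AX mat_mult_left_right_inverse[OF A X AX]] .
  note I = mat_inv[OF A inv]
  have "X = (mat_inv A * A) * X" using I X by simp
  also have "\<dots> = mat_inv A * (A * X)" by (rule assoc_mult_mat[OF I(1) A X])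
  finally show ?thesis using AX I by simp
qed

lemma mat_inv_transpose:
  fixes A :: "'a :: field mat"
  assumes A: "A \<in> carrier_mat n n" and inv: "invertible_mat A"
  shows "invertible_mat A\<^sup>T" "mat_inv A\<^sup>T = (mat_inv A)\<^sup>T"
proof -
  note I = mat_inv[OF A inv]
  have *: "A\<^sup>T * (mat_inv A)\<^sup>T = 1\<^sub>m n" "(mat_inv A)\<^sup>T * A\<^sup>T = 1\<^sub>m n"
    unfolding transpose_mult[OF I(1) A, symmetric] transpose_mult[OF A I(1), symmetric] I(2,3)
    by simp_all
  show "invertible_mat A\<^sup>T" using A I(1) * by (intro invertible_matI[of _ n]) auto
  show "mat_inv A\<^sup>T = (mat_inv A)\<^sup>T" using A I(1) * by (intro mat_inv_unique[of _ n]) auto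
qed

lemma mat_prod_Nil [simp]: "mat_prod n [] = 1\<^sub>m n"
  and mat_prod_Cons [simp]: "mat_prod n (A # As) = A * mat_prod n As"
  by (simp_all add: mat_prod_def)

lemma mat_prod_carrier:
  "(\<And>A. A \<in> set As \<Longrightarrow> A \<in> carrier_mat n n) \<Longrightarrow> mat_prod n As \<in> carrier_mat n n"
  by (induction As) (auto intro: mult_carrier_mat)

lemma mat_prod_append:
  assumes "\<And>A. A \<in> set As \<union> set Cs \<Longrightarrow> A \<in> carrier_mat n n"
  shows "mat_prod n (As @ Cs) = mat_prod n As * mat_prod n Cs"
  using assms
proof (induction As)
  case Nil
  then show ?case using mat_prod_carrier[of Cs n] by simp
next
  case (Cons A As)
  then show ?case
    using assoc_mult_mat[of A n n "mat_prod n As" n "mat_prod n Cs" n]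
      mat_prod_carrier[of As n] mat_prod_carrier[of Cs n] by simp
qed

lemma mat_inv_mat_prod:
  fixes As :: "'a :: field mat list"
  assumes "\<And>A. A \<in> set As \<Longrightarrow> A \<in> carrier_mat n n" "\<And>A. A \<in> set As \<Longrightarrow> invertible_mat A"
  shows "invertible_mat (mat_prod n As) \<and>
    mat_inv (mat_prod n As) = mat_prod n (map mat_inv (rev As))"
  using assms
proof (induction As)
  case Nil
  show ?case
    using mat_inv_unique[of "1\<^sub>m n" n "1\<^sub>m n"] invertible_matI[of "1\<^sub>m n" n "1\<^sub>m n"] by simp
next
  case (Cons A As)
  let ?P = "mat_prod n As"
  have P: "?P \<in> carrier_mat n n" and A: "A \<in> carrier_mat n n" and invA: "invertible_mat A"
    and invP: "invertible_mat ?P"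
    using Cons by (auto intro: mat_prod_carrier)
  note IA = mat_inv[OF A invA] and IP = mat_inv[OF P invP]
  have "(A * ?P) * (mat_inv ?P * mat_inv A) = A * ((?P * mat_inv ?P) * mat_inv A)"
    using A P IA(1) IP(1) by (simp add: assoc_mult_mat[of _ n n _ n _ n])
  then have eq: "(A * ?P) * (mat_inv ?P * mat_inv A) = 1\<^sub>m n"
    using IA IP by simp
  have AP: "A * ?P \<in> carrier_mat n n" and X: "mat_inv ?P * mat_inv A \<in> carrier_mat n n"
    using A P IA IP by auto
  have "mat_prod n (map mat_inv (rev (A # As)))
      = mat_prod n (map mat_inv (rev As)) * mat_prod n [mat_inv A]"
    using mat_prod_append[of "map mat_inv (rev As)" "[mat_inv A]" n] Cons.prems mat_inv(1) IA(1)
    by auto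
  then have "mat_prod n (map mat_inv (rev (A # As))) = mat_inv ?P * mat_inv A"
    using Cons IA(1) by simp
  then show ?case
    using mat_inv_unique[OF AP X eq]
      invertible_matI[OF AP X eq mat_mult_left_right_inverse[OF AP X eq]] by simp
qed

lemma mat_inv_mat_prod_map:
  fixes f :: "'i \<Rightarrow> 'a :: field mat"
  assumes "\<And>r. r \<in> set rs \<Longrightarrow> f r \<in> carrier_mat n n" "\<And>r. r \<in> set rs \<Longrightarrow> invertible_mat (f r)"
  shows "invertible_mat (mat_prod n (map f rs)) \<and>
    mat_inv (mat_prod n (map f rs)) = mat_prod n (map (\<lambda>r. mat_inv (f r)) (rev rs))"
  using mat_inv_mat_prod[of "map f rs" n] assms by (auto simp: rev_map o_def)

section \<open>Accumulated relative errors\<close>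

text \<open>A quantity computed with \<open>m\<close> multiplications or divisions by factors \<open>1 + \<epsilon>\<close> with
  \<open>\<bar>\<epsilon>\<bar> \<le> \<delta>\<close> carries a relative error \<open>\<theta>\<close> with \<open>\<bar>\<theta>\<bar> \<le> m \<delta> / (1 - m \<delta>)\<close>. Adding one on
  both sides turns this bound into \<open>1 / (1 - m \<delta>)\<close>, and it then propagates through one
  more factor because \<open>(1 - m \<delta>) (1 - \<delta>) \<ge> 1 - (m + 1) \<delta>\<close>.\<close>

definition rel_perturb :: "real \<Rightarrow> nat \<Rightarrow> complex \<Rightarrow> complex \<Rightarrow> bool"
  where "rel_perturb \<delta> m x y \<longleftrightarrow>
    (\<exists>\<rho>. y = x * \<rho> \<and> cmod (\<rho> - 1) + 1 \<le> 1 / (1 - real m * \<delta>))"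

lemma rel_perturb_refl: "rel_perturb \<delta> 0 x x"
  unfolding rel_perturb_def by (auto intro: exI[of _ 1])

lemma rel_perturb_one_step:
  assumes "0 \<le> \<delta>" and m: "real (Suc m) * \<delta> < 1"
  shows "1 / (1 - real m * \<delta>) * (1 / (1 - \<delta>)) \<le> 1 / (1 - real (Suc m) * \<delta>)"
    and "1 / (1 - real m * \<delta>) * (1 + \<delta>) \<le> 1 / (1 - real (Suc m) * \<delta>)"
proof -
  have m\<delta>: "0 \<le> real m * \<delta>" "real m * \<delta> + \<delta> < 1" using assms by (auto simp: algebra_simps)
  have "1 - real (Suc m) * \<delta> \<le> (1 - real m * \<delta>) * (1 - \<delta>)"
    using assms by (simp add: algebra_simps)
  then show *: "1 / (1 - real m * \<delta>) * (1 / (1 - \<delta>)) \<le> 1 / (1 - real (Suc m) * \<delta>)"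
    using m frac_le[of 1 1 "1 - real (Suc m) * \<delta>" "(1 - real m * \<delta>) * (1 - \<delta>)"] by simp
  \<comment> \<open>A multiplication is no worse than a division, since \<open>1 + \<delta> \<le> 1 / (1 - \<delta>)\<close>.\<close>
  have "(1 + \<delta>) * (1 - \<delta>) \<le> 1" by (simp add: algebra_simps)
  then have "1 + \<delta> \<le> 1 / (1 - \<delta>)" using m\<delta> by (simp add: pos_le_divide_eq)
  then have "1 / (1 - real m * \<delta>) * (1 + \<delta>) \<le> 1 / (1 - real m * \<delta>) * (1 / (1 - \<delta>))"
    using m\<delta> assms(1) by (intro mult_left_mono) auto
  with * show "1 / (1 - real m * \<delta>) * (1 + \<delta>) \<le> 1 / (1 - real (Suc m) * \<delta>)" by linarith
qed

lemma rel_perturb_mult: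
  assumes "0 \<le> \<delta>" "real (Suc m) * \<delta> < 1" "cmod \<epsilon> \<le> \<delta>" "rel_perturb \<delta> m x y"
  shows "rel_perturb \<delta> (Suc m) (x * a) (y * (a * (1 + \<epsilon>)))"
proof -
  from assms(4) obtain \<rho> where y: "y = x * \<rho>"
    and \<rho>: "cmod (\<rho> - 1) + 1 \<le> 1 / (1 - real m * \<delta>)"
    unfolding rel_perturb_def by blast
  have "\<rho> * (1 + \<epsilon>) - 1 = (\<rho> - 1) * (1 + \<epsilon>) + \<epsilon>" by (simp add: algebra_simps)
  moreover have "cmod (1 + \<epsilon>) \<le> 1 + \<delta>" using norm_triangle_ineq[of 1 \<epsilon>] assms(3) by simp
  ultimately have "cmod (\<rho> * (1 + \<epsilon>) - 1) \<le> cmod (\<rho> - 1) * (1 + \<delta>) + \<delta>"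
    using norm_triangle_ineq[of "(\<rho> - 1) * (1 + \<epsilon>)" \<epsilon>] assms(3)
      mult_left_mono[of "cmod (1 + \<epsilon>)" "1 + \<delta>" "cmod (\<rho> - 1)"] by (simp add: norm_mult)
  then have "cmod (\<rho> * (1 + \<epsilon>) - 1) + 1 \<le> (cmod (\<rho> - 1) + 1) * (1 + \<delta>)"
    by (simp add: algebra_simps)
  also have "\<dots> \<le> 1 / (1 - real m * \<delta>) * (1 + \<delta>)"
    using \<rho> assms(1) by (intro mult_right_mono) auto
  also have "\<dots> \<le> 1 / (1 - real (Suc m) * \<delta>)" by (rule rel_perturb_one_step(2)[OF assms(1,2)])
  finally show ?thesis
    unfolding rel_perturb_def y by (intro exI[of _ "\<rho> * (1 + \<epsilon>)"]) (simp add: mult_ac)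
qed

lemma rel_perturb_divide:
  assumes "0 \<le> \<delta>" "real (Suc m) * \<delta> < 1" "cmod \<epsilon> \<le> \<delta>" "rel_perturb \<delta> m x y"
  shows "rel_perturb \<delta> (Suc m) (x / a) (y / (a * (1 + \<epsilon>)))"
proof -
  from assms(4) obtain \<rho> where y: "y = x * \<rho>"
    and \<rho>: "cmod (\<rho> - 1) + 1 \<le> 1 / (1 - real m * \<delta>)"
    unfolding rel_perturb_def by blast
  have "0 \<le> real m * \<delta>" "real m * \<delta> + \<delta> < 1" using assms by (auto simp: algebra_simps)
  then have \<delta>: "\<delta> < 1" by linarith
  have low: "1 - \<delta> \<le> cmod (1 + \<epsilon>)"
    using norm_diff_ineq[of 1 \<epsilon>] assms(3) by simp
  then have nz: "1 + \<epsilon> \<noteq> 0" using \<delta> by (metis diff_gt_0_iff_gt norm_zero not_le)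
  have "\<rho> / (1 + \<epsilon>) - 1 = ((\<rho> - 1) - \<epsilon>) / (1 + \<epsilon>)" using nz by (simp add: field_simps)
  moreover have "cmod ((\<rho> - 1) - \<epsilon>) \<le> cmod (\<rho> - 1) + \<delta>"
    using norm_triangle_ineq4[of "\<rho> - 1" \<epsilon>] assms(3) by linarith
  ultimately have "cmod (\<rho> / (1 + \<epsilon>) - 1) \<le> (cmod (\<rho> - 1) + \<delta>) / (1 - \<delta>)"
    using low \<delta> frac_le[of "cmod (\<rho> - 1) + \<delta>" "cmod ((\<rho> - 1) - \<epsilon>)" "1 - \<delta>" "cmod (1 + \<epsilon>)"] assms(1)
    by (simp add: norm_divide)
  then have "cmod (\<rho> / (1 + \<epsilon>) - 1) + 1 \<le> (cmod (\<rho> - 1) + 1) * (1 / (1 - \<delta>))"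
    using \<delta> by (simp add: field_simps)
  also have "\<dots> \<le> 1 / (1 - real m * \<delta>) * (1 / (1 - \<delta>))"
    using \<rho> \<delta> by (intro mult_right_mono) auto
  also have "\<dots> \<le> 1 / (1 - real (Suc m) * \<delta>)" by (rule rel_perturb_one_step(1)[OF assms(1,2)])
  finally show ?thesis
    unfolding rel_perturb_def y by (intro exI[of _ "\<rho> / (1 + \<epsilon>)"]) simp
qed

lemma rel_perturb_bound:
  assumes "rel_perturb \<delta> m x y" "0 \<le> \<delta>" "m \<le> M" "real M * \<delta> < 1"
  shows "cmod (y - x) \<le> real M * \<delta> / (1 - real M * \<delta>) * cmod x"
proof -
  from assms(1) obtain \<rho> where y: "y = x * \<rho>"
    and \<rho>: "cmod (\<rho> - 1) + 1 \<le> 1 / (1 - real m * \<delta>)"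
    unfolding rel_perturb_def by blast
  have "real m * \<delta> \<le> real M * \<delta>" using assms by (intro mult_right_mono) auto
  then have "1 / (1 - real m * \<delta>) \<le> 1 / (1 - real M * \<delta>)" using assms by (intro divide_left_mono) auto
  moreover have "1 / (1 - real M * \<delta>) = real M * \<delta> / (1 - real M * \<delta>) + 1"
    using assms(4) by (simp add: field_simps)
  ultimately have "cmod (\<rho> - 1) \<le> real M * \<delta> / (1 - real M * \<delta>)" using \<rho> by linarith
  moreover have "cmod (y - x) = cmod (\<rho> - 1) * cmod x"
    unfolding y by (metis mult.commute mult.right_neutral norm_mult right_diff_distrib)
  ultimately show ?thesis by (metis mult_right_mono norm_ge_zero)
qed

lemma rel_perturb_factor:
  assumes "cmod e \<le> \<delta> * cmod a" "0 \<le> \<delta>"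
  obtains \<epsilon> where "a + e = a * (1 + \<epsilon>)" "cmod \<epsilon> \<le> \<delta>"
proof (cases "a = 0")
  case True
  then show ?thesis using assms that[of 0] by simp
next
  case False
  then show ?thesis using assms that[of "e / a"] by (simp add: field_simps norm_divide)
qed

section \<open>The inverse of a bidiagonal matrix\<close>

lemma upper_bidiagonal_imp_upper_triangular:
  assumes "upper_bidiagonal A" "A \<in> carrier_mat n n"
  shows "upper_triangular A"
  using assms unfolding upper_bidiagonal_def by (auto intro!: upper_triangularI)

lemma upper_bidiagonal_invertible_iff:
  assumes A: "A \<in> carrier_mat n n" and "upper_bidiagonal A"
  shows "invertible_mat A \<longleftrightarrow> (\<forall>i<n. A $$ (i, i) \<noteq> 0)"
proof -
  have "det A = prod_list (diag_mat A)"
    using assms by (intro det_upper_triangular upper_bidiagonal_imp_upper_triangular)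
  then have "det A \<noteq> 0 \<longleftrightarrow> (\<forall>i<n. A $$ (i, i) \<noteq> 0)"
    using A by (auto simp: prod_list_zero_iff diag_mat_def)
  then show ?thesis
    using invertible_mat_if_det_nz[OF A] det_nz_if_invertible_mat[OF A] by blast
qed

text \<open>Back substitution in \<open>A X = I\<close>: row \<open>i\<close> of \<open>A\<close> couples row \<open>i\<close> of \<open>X\<close> only to
  the row below it. So each entry of \<open>X\<close> on or above the diagonal is, up to sign, the
  reciprocal of a diagonal entry of \<open>A\<close> times quotients of entries, with no additions and hence no cancellation; both the
  componentwise error bound and the sign pattern of the inverse rest on this.\<close>

lemma upper_bidiagonal_inverse_entries:
  fixes A X :: "complex mat"
  assumes A: "A \<in> carrier_mat n n" and X: "X \<in> carrier_mat n n" and AX: "A * X = 1\<^sub>m n"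
    and bd: "upper_bidiagonal A" and nz: "\<forall>i<n. A $$ (i, i) \<noteq> 0"
  shows "j < i \<Longrightarrow> i < n \<Longrightarrow> X $$ (i, j) = 0"
    and "j < n \<Longrightarrow> X $$ (j, j) = 1 / A $$ (j, j)"
    and "i < j \<Longrightarrow> j < n \<Longrightarrow> X $$ (i, j) = - (X $$ (Suc i, j) * A $$ (i, Suc i) / A $$ (i, i))"
proof -
  have row: "A $$ (i, i) * X $$ (i, j)
      + (if Suc i < n then A $$ (i, Suc i) * X $$ (Suc i, j) else 0) = (if i = j then 1 else 0)"
    if i: "i < n" and j: "j < n" for i j
  proof -
    have "(if i = j then 1 else 0) = (A * X) $$ (i, j)" using AX i j by simp
    also have "\<dots> = (\<Sum>l<n. A $$ (i, l) * X $$ (l, j))"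
      by (rule index_mult_mat_sum[OF A X i j])
    also have "\<dots> = (\<Sum>l\<in>{i, Suc i} \<inter> {..<n}. A $$ (i, l) * X $$ (l, j))"
      using bd A i unfolding upper_bidiagonal_def by (intro sum.mono_neutral_right) auto
    also have "{i, Suc i} \<inter> {..<n} = (if Suc i < n then {i, Suc i} else {i})" using i by auto
    finally show ?thesis by auto
  qed
  have below: "X $$ (i, j) = 0" if "j < i" "i < n" for i j
    using that
  proof (induction "n - i" arbitrary: i)
    case 0
    then show ?case by simp
  next
    case (Suc d)
    have "Suc i < n \<longrightarrow> X $$ (Suc i, j) = 0" using Suc by auto
    then show ?case using row[of i j] nz Suc.prems by (auto split: if_splits)
  qed
  then show "j < i \<Longrightarrow> i < n \<Longrightarrow> X $$ (i, j) = 0" .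
  show "X $$ (j, j) = 1 / A $$ (j, j)" if "j < n"
    using row[of j j] nz below[of j "Suc j"] that by (auto simp: field_simps split: if_splits)
  show "X $$ (i, j) = - (X $$ (Suc i, j) * A $$ (i, Suc i) / A $$ (i, i))" if "i < j" "j < n"
    using row[of i j] nz that by (simp add: field_simps eq_neg_iff_add_eq_0)
qed

text \<open>In position \<open>(i, j)\<close> of the inverse, where \<open>i \<le> j\<close>, \<open>j - i + 1\<close> diagonal and \<open>j - i\<close> off-diagonal
  entries of \<open>A\<close> occur, so that at most \<open>2 n - 1\<close> perturbed factors enter.\<close>

lemma upper_bidiagonal_inverse_perturbation:
  fixes A E :: "complex mat"
  assumes A: "A \<in> carrier_mat n n" and E: "E \<in> carrier_mat n n"
    and inv: "invertible_mat A" and bd: "upper_bidiagonal A"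
    and \<delta>: "0 \<le> \<delta>" "real (2 * n - 1) * \<delta> < 1"
    and E_le: "\<And>i j. i < n \<Longrightarrow> j < n \<Longrightarrow> cmod (E $$ (i, j)) \<le> \<delta> * cmod (A $$ (i, j))"
  shows "invertible_mat (A + E)"
    and "i < n \<Longrightarrow> j < n \<Longrightarrow> cmod (mat_inv (A + E) $$ (i, j) - mat_inv A $$ (i, j))
      \<le> real (2 * n - 1) * \<delta> / (1 - real (2 * n - 1) * \<delta>) * cmod (mat_inv A $$ (i, j))"
proof -
  let ?X = "mat_inv A" and ?Y = "mat_inv (A + E)"
  have AE: "A + E \<in> carrier_mat n n" using A E by simp
  have nz: "\<forall>i<n. A $$ (i, i) \<noteq> 0"
    using inv upper_bidiagonal_invertible_iff[OF A bd] by simp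
  \<comment> \<open>A componentwise relative error leaves zero entries zero.\<close>
  have bd': "upper_bidiagonal (A + E)"
    unfolding upper_bidiagonal_def
  proof (intro allI impI)
    fix i j assume "i < dim_row (A + E)" "j < dim_col (A + E)" "j \<noteq> i \<and> j \<noteq> i + 1"
    then have "A $$ (i, j) = 0" "i < n" "j < n" using bd A E unfolding upper_bidiagonal_def by auto
    then show "(A + E) $$ (i, j) = 0" using A E E_le[of i j] by simp
  qed
  have small: "real m * \<delta> < 1" if "m \<le> 2 * n - 1" for m
    using that \<delta> mult_right_mono[of "real m" "real (2 * n - 1)" \<delta>] by linarith
  have nz': "\<forall>i<n. (A + E) $$ (i, i) \<noteq> 0"
  proof (intro allI impI notI)
    fix i assume i: "i < n"
    assume "(A + E) $$ (i, i) = 0"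
    then have "cmod (E $$ (i, i)) = cmod (A $$ (i, i))"
      using A E i by (simp add: add_eq_0_iff)
    then have "1 * cmod (A $$ (i, i)) \<le> \<delta> * cmod (A $$ (i, i))" using E_le[of i i] i by simp
    moreover have "\<delta> < 1" using small[of 1] i by simp
    ultimately show False using nz i by simp
  qed
  show inv': "invertible_mat (A + E)"
    using nz' upper_bidiagonal_invertible_iff[OF AE bd'] by simp
  note X = upper_bidiagonal_inverse_entries[OF A mat_inv(1,2)[OF A inv] bd nz]
  note Y = upper_bidiagonal_inverse_entries[OF AE mat_inv(1,2)[OF AE inv'] bd' nz']
  have rel: "rel_perturb \<delta> (Suc (2 * (j - i))) (?X $$ (i, j)) (?Y $$ (i, j))"
    if "i \<le> j" "j < n" for i j
    using that
  proof (induction rule: inc_induct)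
    case base
    have j: "j < n" using base by simp
    obtain \<epsilon> where \<epsilon>: "A $$ (j, j) + E $$ (j, j) = A $$ (j, j) * (1 + \<epsilon>)" "cmod \<epsilon> \<le> \<delta>"
      using rel_perturb_factor[OF E_le[OF j j] \<delta>(1)] .
    have "real (Suc 0) * \<delta> < 1" using small[of 1] j by simp
    from rel_perturb_divide[OF \<delta>(1) this \<epsilon>(2) rel_perturb_refl]
    have "rel_perturb \<delta> (Suc 0) (1 / A $$ (j, j)) (1 / (A + E) $$ (j, j))"
      using A E j \<epsilon>(1) by simp
    then show ?case using X(2)[OF j] Y(2)[OF j] by simp
  next
    case (step i)
    \<comment> \<open>Going up one row costs two factors: one multiplication and one division.\<close>
    let ?m = "2 * (j - i)"
    have i: "i < n" "Suc i < n" and m: "Suc (2 * (j - Suc i)) = ?m - 1" "?m \<noteq> 0"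
      using step by auto
    obtain \<epsilon> where \<epsilon>: "A $$ (i, Suc i) + E $$ (i, Suc i) = A $$ (i, Suc i) * (1 + \<epsilon>)" "cmod \<epsilon> \<le> \<delta>"
      using rel_perturb_factor[OF E_le[OF i] \<delta>(1)] .
    obtain \<eta> where \<eta>: "A $$ (i, i) + E $$ (i, i) = A $$ (i, i) * (1 + \<eta>)" "cmod \<eta> \<le> \<delta>"
      using rel_perturb_factor[OF E_le[OF i(1) i(1)] \<delta>(1)] .
    have "rel_perturb \<delta> (?m - 1) (?X $$ (Suc i, j)) (?Y $$ (Suc i, j))"
      using step.IH step.prems m by simp
    from rel_perturb_mult[OF \<delta>(1) _ \<epsilon>(2) this, of "A $$ (i, Suc i)"]
    have "rel_perturb \<delta> ?m (?X $$ (Suc i, j) * A $$ (i, Suc i))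
        (?Y $$ (Suc i, j) * (A + E) $$ (i, Suc i))"
      using small[of ?m] m(2) step A E i \<epsilon>(1) by simp
    from rel_perturb_divide[OF \<delta>(1) _ \<eta>(2) this, of "A $$ (i, i)"]
    have "rel_perturb \<delta> (Suc ?m) (?X $$ (Suc i, j) * A $$ (i, Suc i) / A $$ (i, i))
        (?Y $$ (Suc i, j) * (A + E) $$ (i, Suc i) / (A + E) $$ (i, i))"
      using small[of "Suc ?m"] step A E i \<eta>(1) by simp
    then have "rel_perturb \<delta> (Suc ?m) (- (?X $$ (Suc i, j) * A $$ (i, Suc i) / A $$ (i, i)))
        (- (?Y $$ (Suc i, j) * (A + E) $$ (i, Suc i) / (A + E) $$ (i, i)))"
      unfolding rel_perturb_def by (metis mult_minus_left)
    then show ?case using X(3)[of i j] Y(3)[of i j] step by simp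
  qed
  show "cmod (?Y $$ (i, j) - ?X $$ (i, j))
      \<le> real (2 * n - 1) * \<delta> / (1 - real (2 * n - 1) * \<delta>) * cmod (?X $$ (i, j))"
    if "i < n" "j < n" for i j
  proof (cases "i \<le> j")
    case True
    then show ?thesis
      using that by (intro rel_perturb_bound[OF rel[OF True that(2)] \<delta>(1) _ \<delta>(2)]) linarith
  next
    case False
    then show ?thesis using X(1)[of j i] Y(1)[of j i] that by simp
  qed
qed

text \<open>Hypotheses and bound are invariant under transposition, which exchanges the upper and
  the lower case.\<close>

lemma bidiagonal_inverse_perturbation:
  fixes A E :: "complex mat"
  assumes A: "A \<in> carrier_mat n n" and E: "E \<in> carrier_mat n n"
    and inv: "invertible_mat A" and bd: "bidiagonal A"
    and \<delta>: "0 \<le> \<delta>" "real (2 * n - 1) * \<delta> < 1"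
    and E_le: "\<And>i j. i < n \<Longrightarrow> j < n \<Longrightarrow> cmod (E $$ (i, j)) \<le> \<delta> * cmod (A $$ (i, j))"
  shows "invertible_mat (A + E) \<and> (\<forall>i<n. \<forall>j<n.
      cmod (mat_inv (A + E) $$ (i, j) - mat_inv A $$ (i, j))
      \<le> real (2 * n - 1) * \<delta> / (1 - real (2 * n - 1) * \<delta>) * cmod (mat_inv A $$ (i, j)))"
proof (cases "upper_bidiagonal A")
  case True
  then show ?thesis using upper_bidiagonal_inverse_perturbation[OF A E inv True \<delta> E_le] by blast
next
  case False
  then have bd': "upper_bidiagonal A\<^sup>T" using bd unfolding bidiagonal_def lower_bidiagonal_def by simp
  have T: "A\<^sup>T \<in> carrier_mat n n" "E\<^sup>T \<in> carrier_mat n n" using A E by auto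
  have AE: "A + E \<in> carrier_mat n n" using A E by simp
  have sum: "A\<^sup>T + E\<^sup>T = (A + E)\<^sup>T" using A E by (simp add: transpose_add)
  have E_le': "cmod (E\<^sup>T $$ (i, j)) \<le> \<delta> * cmod (A\<^sup>T $$ (i, j))" if "i < n" "j < n" for i j
    using A E E_le that by simp
  note upper = upper_bidiagonal_inverse_perturbation[OF T mat_inv_transpose(1)[OF A inv] bd' \<delta>]
  have pert: "invertible_mat (A + E)\<^sup>T"
    using upper(1) E_le' unfolding sum by blast
  have pert_le: "cmod (mat_inv (A + E)\<^sup>T $$ (i, j) - mat_inv A\<^sup>T $$ (i, j))
      \<le> real (2 * n - 1) * \<delta> / (1 - real (2 * n - 1) * \<delta>) * cmod (mat_inv A\<^sup>T $$ (i, j))"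
    if "i < n" "j < n" for i j
    using upper(2)[OF E_le' that] unfolding sum by blast
  have inv': "invertible_mat (A + E)"
    using mat_inv_transpose(1)[OF _ pert] AE by simp
  have "cmod (mat_inv (A + E) $$ (i, j) - mat_inv A $$ (i, j))
      \<le> real (2 * n - 1) * \<delta> / (1 - real (2 * n - 1) * \<delta>) * cmod (mat_inv A $$ (i, j))"
    if "i < n" "j < n" for i j
    using pert_le[OF that(2,1)] mat_inv(1)[OF A inv] mat_inv(1)[OF AE inv'] that
    unfolding mat_inv_transpose(2)[OF A inv] mat_inv_transpose(2)[OF AE inv'] by simp
  with inv' show ?thesis by blast
qed

section \<open>Products without cancellation\<close>

text \<open>\<open>A\<close> equals \<open>D \<bar>A\<bar> D\<close> for the signature matrix \<open>D = diag s\<close>. The choice \<open>s = 1\<close> says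
  that \<open>A\<close> is nonnegative, and \<open>s i = (-1) ^ i\<close> that its signs form a checkerboard.\<close>

definition signature_similar_abs :: "(nat \<Rightarrow> real) \<Rightarrow> complex mat \<Rightarrow> bool"
  where "signature_similar_abs s A \<longleftrightarrow> (\<forall>i < dim_row A. \<forall>j < dim_col A.
    A $$ (i, j) = of_real (s i * s j * cmod (A $$ (i, j))))"

lemma mat_abs_carrier [simp]: "mat_abs A \<in> carrier_mat n m \<longleftrightarrow> A \<in> carrier_mat n m"
  unfolding mat_abs_def by auto

lemma index_mat_abs [simp]:
  "A \<in> carrier_mat n m \<Longrightarrow> i < n \<Longrightarrow> j < m \<Longrightarrow> mat_abs A $$ (i, j) = cmod (A $$ (i, j))"
  unfolding mat_abs_def by auto

text \<open>For a common signature, \<open>D \<bar>A\<bar> D D \<bar>C\<bar> D = D \<bar>A\<bar> \<bar>C\<bar> D\<close>, because \<open>D D = I\<close>. Thus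
  taking absolute values commutes with the product.\<close>

lemma signature_similar_abs_mat_prod:
  assumes s: "\<And>i. s i * s i = 1"
    and "\<And>A. A \<in> set As \<Longrightarrow> A \<in> carrier_mat n n"
    and "\<And>A. A \<in> set As \<Longrightarrow> signature_similar_abs s A"
  shows "signature_similar_abs s (mat_prod n As) \<and>
    mat_abs (mat_prod n As) = mat_prod n (map mat_abs As)"
  using assms(2,3)
proof (induction As)
  case Nil
  show ?case using s by (auto simp: signature_similar_abs_def mat_abs_def simp del: of_real_mult)
next
  case (Cons A As)
  let ?P = "mat_prod n As"
  have A: "A \<in> carrier_mat n n" and P: "?P \<in> carrier_mat n n"
    using Cons.prems by (auto intro: mat_prod_carrier)
  have sA: "signature_similar_abs s A" and sP: "signature_similar_abs s ?P"
    and abs_P: "mat_abs ?P = mat_prod n (map mat_abs As)" using Cons by auto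
  have s_abs: "\<bar>s i\<bar> = 1" for i using s[of i] by (auto simp: square_eq_1_iff)
  have entry: "(A * ?P) $$ (i, j) = of_real (s i * s j * (mat_abs A * mat_abs ?P) $$ (i, j))
      \<and> (mat_abs A * mat_abs ?P) $$ (i, j) = cmod ((A * ?P) $$ (i, j))"
    if ij: "i < n" "j < n" for i j
  proof -
    have M: "(mat_abs A * mat_abs ?P) $$ (i, j) = (\<Sum>l<n. cmod (A $$ (i, l)) * cmod (?P $$ (l, j)))"
      using A P ij by (subst index_mult_mat_sum[of _ n n _ n]) auto
    have "(A * ?P) $$ (i, j) = (\<Sum>l<n. A $$ (i, l) * ?P $$ (l, j))"
      by (rule index_mult_mat_sum[OF A P ij])
    also have "\<dots> = (\<Sum>l<n. of_real (s i * s j * (cmod (A $$ (i, l)) * cmod (?P $$ (l, j)))))"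
    proof (rule sum.cong[OF refl])
      fix l assume l: "l \<in> {..<n}"
      have "A $$ (i, l) * ?P $$ (l, j)
          = of_real (s i * s l * cmod (A $$ (i, l))) * of_real (s l * s j * cmod (?P $$ (l, j)))"
        using sA sP A P ij l unfolding signature_similar_abs_def
        by (metis carrier_matD lessThan_iff)
      also have "\<dots> = of_real (s i * (s l * s l) * s j * (cmod (A $$ (i, l)) * cmod (?P $$ (l, j))))"
        by simp
      finally show "A $$ (i, l) * ?P $$ (l, j)
          = of_real (s i * s j * (cmod (A $$ (i, l)) * cmod (?P $$ (l, j))))"
        unfolding s by simp
    qed
    also have "\<dots> = of_real (s i * s j * (mat_abs A * mat_abs ?P) $$ (i, j))"
      unfolding M by (simp add: sum_distrib_left)
    finally have eq: "(A * ?P) $$ (i, j) = of_real (s i * s j * (mat_abs A * mat_abs ?P) $$ (i, j))" .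
    have "0 \<le> (mat_abs A * mat_abs ?P) $$ (i, j)" unfolding M by (intro sum_nonneg) auto
    then show ?thesis using eq s_abs by (simp only: norm_of_real abs_mult) simp
  qed
  have "signature_similar_abs s (A * ?P)"
    unfolding signature_similar_abs_def
  proof (intro allI impI)
    fix i j assume "i < dim_row (A * ?P)" "j < dim_col (A * ?P)"
    then have "i < n" "j < n" using A P by auto
    from entry[OF this]
    show "(A * ?P) $$ (i, j) = of_real (s i * s j * cmod ((A * ?P) $$ (i, j)))" by metis
  qed
  moreover have "mat_abs (A * ?P) = mat_abs A * mat_abs ?P"
  proof (rule eq_matI)
    fix i j assume "i < dim_row (mat_abs A * mat_abs ?P)" "j < dim_col (mat_abs A * mat_abs ?P)"
    then have ij: "i < n" "j < n" using A P by (auto simp: mat_abs_def)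
    show "mat_abs (A * ?P) $$ (i, j) = (mat_abs A * mat_abs ?P) $$ (i, j)"
      by (rule trans[OF index_mat_abs[OF mult_carrier_mat[OF A P] ij]
            conjunct2[OF entry[OF ij], symmetric]])
  qed (auto simp: mat_abs_def)
  ultimately show ?case using abs_P by simp
qed

lemma signature_similar_abs_transpose:
  "signature_similar_abs s A\<^sup>T \<longleftrightarrow> signature_similar_abs s A"
proof -
  have "A\<^sup>T $$ (i, j) = of_real (s i * s j * cmod (A\<^sup>T $$ (i, j)))
      \<longleftrightarrow> A $$ (j, i) = of_real (s j * s i * cmod (A $$ (j, i)))"
    if "i < dim_col A" "j < dim_row A" for i j
    unfolding index_transpose_mat(1)[OF that] mult.commute[of "s i" "s j"] ..
  then show ?thesis unfolding signature_similar_abs_def index_transpose_mat(2,3) by blast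
qed

lemma nonneg_mat_iff_signature_similar_abs:
  "nonneg_mat A \<longleftrightarrow> signature_similar_abs (\<lambda>_. 1) A"
proof -
  have "z \<in> \<real>\<^sub>\<ge>\<^sub>0 \<longleftrightarrow> z = of_real (1 * 1 * cmod z)" for z :: complex
    by (metis mult_1 nonneg_Reals_cases nonneg_Reals_of_real_iff norm_ge_zero norm_of_real abs_of_nonneg)
  then show ?thesis unfolding nonneg_mat_def signature_similar_abs_def by blast
qed

text \<open>Each step of back substitution brings in exactly one minus sign, so the inverse of a
  nonnegative bidiagonal matrix has the sign \<open>(-1) ^ (i + j)\<close> in position \<open>(i, j)\<close>.\<close>

lemma nonneg_upper_bidiagonal_inverse_signs:
  assumes A: "A \<in> carrier_mat n n" and inv: "invertible_mat A" and bd: "upper_bidiagonal A"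
    and nonneg: "nonneg_mat A"
  shows "signature_similar_abs (\<lambda>i. (- 1) ^ i) (mat_inv A)"
proof -
  let ?X = "mat_inv A"
  have nz: "\<forall>i<n. A $$ (i, i) \<noteq> 0"
    using inv upper_bidiagonal_invertible_iff[OF A bd] by simp
  note I = mat_inv[OF A inv]
  note X = upper_bidiagonal_inverse_entries[OF A I(1,2) bd nz]
  have A_abs: "A $$ (i, j) = of_real (cmod (A $$ (i, j)))" if "i < n" "j < n" for i j
    using nonneg A that unfolding nonneg_mat_iff_signature_similar_abs signature_similar_abs_def
    by auto
  have upper: "?X $$ (i, j) = of_real ((- 1) ^ i * (- 1) ^ j * cmod (?X $$ (i, j)))"
    if "i \<le> j" "j < n" for i j
    using that
  proof (induction rule: inc_induct)
    case base
    define a where "a = cmod (A $$ (j, j))"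
    have "A $$ (j, j) = of_real a" using A_abs base unfolding a_def by blast
    moreover have "0 \<le> a" unfolding a_def by simp
    ultimately show ?case
      using X(2) base by (simp add: norm_divide flip: power_mult_distrib)
  next
    case (step i)
    have i: "i < n" "Suc i < n" using step by auto
    define a b x where "a = cmod (A $$ (i, i))" and "b = cmod (A $$ (i, Suc i))"
      and "x = cmod (?X $$ (Suc i, j))"
    have rec: "?X $$ (i, j) = - (?X $$ (Suc i, j) * A $$ (i, Suc i) / A $$ (i, i))"
      using X(3) step by simp
    have norm: "cmod (?X $$ (i, j)) = x * b / a"
      unfolding rec a_def b_def x_def by (simp add: norm_mult norm_divide)
    have "?X $$ (i, j) = - (of_real ((- 1) ^ Suc i * (- 1) ^ j * x) * of_real b / of_real a)"
      using rec step A_abs[OF i] A_abs[OF i(1) i(1)] unfolding a_def b_def x_def by metis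
    then show ?case unfolding norm by simp
  qed
  have "?X $$ (i, j) = of_real ((- 1) ^ i * (- 1) ^ j * cmod (?X $$ (i, j)))"
    if "i < n" "j < n" for i j
    using upper[of i j] X(1)[of j i] that by (cases "i \<le> j") auto
  then show ?thesis unfolding signature_similar_abs_def using I(1) by auto
qed

lemma nonneg_bidiagonal_inverse_signs:
  assumes A: "A \<in> carrier_mat n n" and inv: "invertible_mat A" and bd: "bidiagonal A"
    and nonneg: "nonneg_mat A"
  shows "signature_similar_abs (\<lambda>i. (- 1) ^ i) (mat_inv A)"
proof (cases "upper_bidiagonal A")
  case True
  then show ?thesis using nonneg_upper_bidiagonal_inverse_signs[OF A inv _ nonneg] by simp
next
  case False
  then have "upper_bidiagonal A\<^sup>T" using bd unfolding bidiagonal_def lower_bidiagonal_def by simp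
  moreover have "nonneg_mat A\<^sup>T"
    using nonneg by (simp add: nonneg_mat_iff_signature_similar_abs signature_similar_abs_transpose)
  ultimately have "signature_similar_abs (\<lambda>i. (- 1) ^ i) (mat_inv A\<^sup>T)"
    using A mat_inv_transpose(1)[OF A inv]
    by (intro nonneg_upper_bidiagonal_inverse_signs[of _ n]) auto
  then show ?thesis
    by (simp add: mat_inv_transpose(2)[OF A inv] signature_similar_abs_transpose)
qed

section \<open>Perturbation of matrix products\<close>

text \<open>Since \<open>Y Q - X P = (Y - X) Q + X (Q - P)\<close> and \<open>\<bar>Q\<bar> \<le> \<bar>P\<bar> + \<bar>Q - P\<bar>\<close>, prepending a
  factor with relative error \<open>\<tau>\<close> turns the bound \<open>c\<close> into \<open>\<tau> (1 + c) + c\<close>, that is,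
  \<open>1 + c\<close> into \<open>(1 + \<tau>) (1 + c)\<close>. The bound is relative to the product of the absolute
  values, which dominates the absolute value of the product.\<close>

lemma mat_prod_perturbation:
  fixes X Y :: "'i \<Rightarrow> complex mat"
  assumes "0 \<le> \<tau>"
    and "\<And>r. r \<in> set rs \<Longrightarrow> X r \<in> carrier_mat n n" "\<And>r. r \<in> set rs \<Longrightarrow> Y r \<in> carrier_mat n n"
    and "\<And>r i j. r \<in> set rs \<Longrightarrow> i < n \<Longrightarrow> j < n \<Longrightarrow>
      cmod (Y r $$ (i, j) - X r $$ (i, j)) \<le> \<tau> * cmod (X r $$ (i, j))"
    and "i < n" "j < n"
  shows "cmod (mat_prod n (map X rs) $$ (i, j)) \<le> mat_prod n (map (\<lambda>r. mat_abs (X r)) rs) $$ (i, j)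
    \<and> cmod (mat_prod n (map Y rs) $$ (i, j) - mat_prod n (map X rs) $$ (i, j))
      \<le> ((1 + \<tau>) ^ length rs - 1) * mat_prod n (map (\<lambda>r. mat_abs (X r)) rs) $$ (i, j)"
  using assms(2-)
proof (induction rs arbitrary: i j)
  case Nil
  then show ?case by simp
next
  case (Cons r rs)
  let ?P = "mat_prod n (map X rs)" and ?Q = "mat_prod n (map Y rs)"
    and ?M = "mat_prod n (map (\<lambda>r. mat_abs (X r)) rs)" and ?c = "(1 + \<tau>) ^ length rs - 1"
  have car: "X r \<in> carrier_mat n n" "Y r \<in> carrier_mat n n" "?P \<in> carrier_mat n n"
      "?Q \<in> carrier_mat n n" "?M \<in> carrier_mat n n"
    using Cons.prems by (auto intro!: mat_prod_carrier)
  have IH: "cmod (?P $$ (l, j)) \<le> ?M $$ (l, j)"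
      "cmod (?Q $$ (l, j) - ?P $$ (l, j)) \<le> ?c * ?M $$ (l, j)" if "l < n" for l
    using Cons.IH[OF _ _ _ that Cons.prems(5)] Cons.prems by auto
  have c: "0 \<le> ?c" using assms(1) by simp
  have eqX: "(X r * ?P) $$ (i, j) = (\<Sum>l<n. X r $$ (i, l) * ?P $$ (l, j))"
    and eqY: "(Y r * ?Q) $$ (i, j) = (\<Sum>l<n. Y r $$ (i, l) * ?Q $$ (l, j))"
    using index_mult_mat_sum car Cons.prems by blast+
  have eqM: "(mat_abs (X r) * ?M) $$ (i, j) = (\<Sum>l<n. cmod (X r $$ (i, l)) * ?M $$ (l, j))"
    using car Cons.prems(4,5)
    by (subst index_mult_mat_sum[of _ n n _ n]) (simp_all add: index_mat_abs[OF car(1)])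
  have "cmod ((X r * ?P) $$ (i, j)) \<le> (mat_abs (X r) * ?M) $$ (i, j)"
    unfolding eqX eqM
    by (intro sum_norm_le) (simp add: norm_mult mult_left_mono IH)
  moreover have "cmod ((Y r * ?Q) $$ (i, j) - (X r * ?P) $$ (i, j))
      \<le> ((1 + \<tau>) ^ Suc (length rs) - 1) * (mat_abs (X r) * ?M) $$ (i, j)"
    unfolding eqX eqY eqM sum_subtractf[symmetric] sum_distrib_left
  proof (intro sum_norm_le)
    fix l assume "l \<in> {..<n}"
    then have l: "l < n" by simp
    define x y p q m where "x = X r $$ (i, l)" and "y = Y r $$ (i, l)" and "p = ?P $$ (l, j)"
      and "q = ?Q $$ (l, j)" and "m = ?M $$ (l, j)"
    have yx: "cmod (y - x) \<le> \<tau> * cmod x" and p: "cmod p \<le> m" and qp: "cmod (q - p) \<le> ?c * m"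
      using Cons.prems(3)[of r i l] Cons.prems(4) l IH[OF l]
      unfolding x_def y_def p_def q_def m_def by auto
    have q: "cmod q \<le> (1 + ?c) * m"
      using norm_triangle_ineq[of "q - p" p] p qp by (simp add: algebra_simps)
    have "y * q - x * p = (y - x) * q + x * (q - p)" by (simp add: algebra_simps)
    then have "cmod (y * q - x * p) \<le> cmod (y - x) * cmod q + cmod x * cmod (q - p)"
      using norm_triangle_ineq[of "(y - x) * q" "x * (q - p)"] by (simp add: norm_mult)
    also have "\<dots> \<le> (\<tau> * cmod x) * ((1 + ?c) * m) + cmod x * (?c * m)"
      using yx q qp assms(1) by (intro add_mono mult_mono) auto
    also have "\<dots> = ((1 + \<tau>) ^ Suc (length rs) - 1) * (cmod x * m)"
      by (simp add: algebra_simps)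
    finally show "cmod (Y r $$ (i, l) * ?Q $$ (l, j) - X r $$ (i, l) * ?P $$ (l, j))
        \<le> ((1 + \<tau>) ^ Suc (length rs) - 1) * (cmod (X r $$ (i, l)) * ?M $$ (l, j))"
      unfolding x_def y_def p_def q_def m_def .
  qed
  ultimately show ?case by simp
qed

theorem theorem2p3:
  fixes n k :: nat
    and Bs \<Delta>Bs :: "nat \<Rightarrow> complex mat"
    and B \<Delta>B :: "complex mat"
    and \<delta> \<tau> :: real
  assumes "\<And>i. i \<in> {1..k} \<Longrightarrow> Bs i \<in> carrier_mat n n"
    and "\<And>i. i \<in> {1..k} \<Longrightarrow> invertible_mat (Bs i)"
    and "\<And>i. i \<in> {1..k} \<Longrightarrow> bidiagonal (Bs i)"
    and "B = mat_prod n (map Bs [1..<k+1])"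
    and "0 \<le> \<delta>"
    and "(2 * real n - 1) * \<delta> < 1"
    and "\<tau> = (2 * real n - 1) * \<delta> / (1 - (2 * real n - 1) * \<delta>)"
    and "\<And>i. i \<in> {1..k} \<Longrightarrow> \<Delta>Bs i \<in> carrier_mat n n"
    and "\<And>i. i \<in> {1..k} \<Longrightarrow> mat_abs (\<Delta>Bs i) \<le> \<delta> \<cdot>\<^sub>m mat_abs (Bs i)"
    and "\<Delta>B \<in> carrier_mat n n"
    and "B + \<Delta>B = mat_prod n (map (\<lambda>i. Bs i + \<Delta>Bs i) [1..<k+1])"
  shows "invertible_mat B \<and> invertible_mat (B + \<Delta>B)
    \<and> mat_abs (mat_inv (B + \<Delta>B) - mat_inv B)
        \<le> ((1 + \<tau>) ^ k - 1) \<cdot>\<^sub>m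
            mat_prod n (map (\<lambda>i. mat_abs (mat_inv (Bs i))) (rev [1..<k+1]))
    \<and> ((\<forall>i\<in>{1..k}. nonneg_mat (Bs i)) \<or> (\<forall>i\<in>{1..k}. nonneg_mat (mat_inv (Bs i))) \<longrightarrow>
        mat_abs (mat_inv (B + \<Delta>B) - mat_inv B)
        \<le> ((1 + \<tau>) ^ k - 1) \<cdot>\<^sub>m mat_abs (mat_inv B))"
proof -
  note car = assms(1) and inv = assms(2) and bd = assms(3) and carE = assms(8)
  define X Y where "X i = mat_inv (Bs i)" and "Y i = mat_inv (Bs i + \<Delta>Bs i)" for i
  define rs where "rs = rev [1..<k+1]"
  let ?c = "(1 + \<tau>) ^ k - 1" and ?M = "mat_prod n (map (\<lambda>i. mat_abs (X i)) rs)"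
  have rs: "set rs = {1..k}" "length rs = k" unfolding rs_def by auto
  have idx: "[1..<k+1] = rev rs" unfolding rs_def by simp
  have E_le: "cmod (\<Delta>Bs r $$ (i, j)) \<le> \<delta> * cmod (Bs r $$ (i, j))"
    if r: "r \<in> {1..k}" and ij: "i < n" "j < n" for r i j
  proof -
    have "mat_abs (\<Delta>Bs r) $$ (i, j) \<le> (\<delta> \<cdot>\<^sub>m mat_abs (Bs r)) $$ (i, j)"
      using assms(9)[OF r] car[OF r] ij unfolding less_eq_mat_def by (auto simp: mat_abs_def)
    then show ?thesis using car[OF r] carE[OF r] ij by (simp add: mat_abs_def)
  qed
  \<comment> \<open>For \<open>n = 0\<close>, the truncated subtraction \<open>2 * n - 1\<close> is 0, and then there are no entries to bound.\<close>
  have small: "real (2 * n - 1) * \<delta> < 1" using assms(6) by (cases n) auto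
  have \<tau>_eq: "real (2 * n - 1) * \<delta> / (1 - real (2 * n - 1) * \<delta>) = \<tau>" if "i < n" for i
    using that assms(7) by (simp add: of_nat_diff)
  have pert: "invertible_mat (Bs r + \<Delta>Bs r) \<and> (\<forall>i<n. \<forall>j<n.
      cmod (Y r $$ (i, j) - X r $$ (i, j)) \<le> \<tau> * cmod (X r $$ (i, j)))" if r: "r \<in> {1..k}" for r
  proof -
    note factor = bidiagonal_inverse_perturbation[OF car[OF r] carE[OF r] inv[OF r] bd[OF r]
        assms(5) small E_le[OF r]]
    show ?thesis
    proof (cases "0 < n")
      case True
      show ?thesis using factor unfolding \<tau>_eq[OF True] X_def Y_def by blast
    next
      case False
      then show ?thesis using factor by simp
    qed
  qed
  have X: "X r \<in> carrier_mat n n" and Y: "Y r \<in> carrier_mat n n" if "r \<in> {1..k}" for r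
    using mat_inv(1)[of "Bs r" n] mat_inv(1)[of "Bs r + \<Delta>Bs r" n] car carE inv pert that
    unfolding X_def Y_def by auto
  have B: "invertible_mat B \<and> mat_inv B = mat_prod n (map X rs)"
    using mat_inv_mat_prod_map[of "rev rs" Bs n] car inv
    unfolding assms(4) X_def idx rs set_rev rev_rev_ident by blast
  have B': "invertible_mat (B + \<Delta>B) \<and> mat_inv (B + \<Delta>B) = mat_prod n (map Y rs)"
  proof -
    have "Bs r + \<Delta>Bs r \<in> carrier_mat n n" if "r \<in> {1..k}" for r using car carE that by simp
    then show ?thesis
      using mat_inv_mat_prod_map[of "rev rs" "\<lambda>i. Bs i + \<Delta>Bs i" n] pert
      unfolding assms(11) Y_def idx rs set_rev rev_rev_ident by blast
  qed
  have car_prods: "mat_inv B \<in> carrier_mat n n" "mat_inv (B + \<Delta>B) \<in> carrier_mat n n"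
      "?M \<in> carrier_mat n n"
    using B B' X Y rs by (auto intro!: mat_prod_carrier)
  have bound: "mat_abs (mat_inv (B + \<Delta>B) - mat_inv B) \<le> ?c \<cdot>\<^sub>m ?M"
    unfolding less_eq_mat_def
  proof (intro conjI allI impI)
    fix i j assume "i < dim_row (?c \<cdot>\<^sub>m ?M)" "j < dim_col (?c \<cdot>\<^sub>m ?M)"
    then have ij: "i < n" "j < n" using car_prods by auto
    have "0 \<le> \<tau>" using assms(5) small unfolding \<tau>_eq[OF ij(1), symmetric] by simp
    then have "cmod (mat_inv (B + \<Delta>B) $$ (i, j) - mat_inv B $$ (i, j)) \<le> ?c * ?M $$ (i, j)"
      using mat_prod_perturbation[of \<tau> rs X n Y i j] X Y pert rs ij B B' by simp
    then show "mat_abs (mat_inv (B + \<Delta>B) - mat_inv B) $$ (i, j) \<le> (?c \<cdot>\<^sub>m ?M) $$ (i, j)"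
      using car_prods ij by (simp add: mat_abs_def)
  qed (use car_prods in \<open>auto simp: mat_abs_def\<close>)
  have abs_prod: "?M = mat_abs (mat_inv B)"
    if nonneg: "(\<forall>i\<in>{1..k}. nonneg_mat (Bs i)) \<or> (\<forall>i\<in>{1..k}. nonneg_mat (mat_inv (Bs i)))"
  proof -
    have "\<exists>s. (\<forall>i. s i * s i = 1) \<and> (\<forall>r\<in>{1..k}. signature_similar_abs s (X r))"
      using nonneg
    proof
      assume "\<forall>i\<in>{1..k}. nonneg_mat (Bs i)"
      then have "\<forall>r\<in>{1..k}. signature_similar_abs (\<lambda>i. (- 1) ^ i) (X r)"
        using nonneg_bidiagonal_inverse_signs[OF car inv bd] unfolding X_def by blast
      then show ?thesis
        by (intro exI[of _ "\<lambda>i. (- 1) ^ i"]) (simp flip: power_mult_distrib)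
    next
      assume "\<forall>i\<in>{1..k}. nonneg_mat (mat_inv (Bs i))"
      then show ?thesis
        unfolding X_def nonneg_mat_iff_signature_similar_abs by (intro exI[of _ "\<lambda>_. 1"]) auto
    qed
    then obtain s where s: "\<And>i. s i * s i = (1 :: real)"
        "\<And>r. r \<in> {1..k} \<Longrightarrow> signature_similar_abs s (X r)"
      by blast
    have "A \<in> carrier_mat n n \<and> signature_similar_abs s A" if "A \<in> set (map X rs)" for A
      using that X s(2) rs(1) by auto
    then have "mat_abs (mat_prod n (map X rs)) = mat_prod n (map mat_abs (map X rs))"
      using signature_similar_abs_mat_prod[of s "map X rs" n] s(1) by blast
    then show ?thesis using B by (simp add: o_def)
  qed
  show ?thesis using B B' bound abs_prod unfolding X_def rs_def by metis
qed

end
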